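(* Let $a<b$ be real numbers, $\Omega=[a,b]$, $m\ge 0$ an integer, and let $\mathcal{X}=\{x_i=a+(i+\tfrac12)\tfrac{b-a}{m+1}:\ i=0,\ldots,m\}$. Consider the bijective map $$S:\Omega\longrightarrow[-1,1],\qquad S(x)=-\cos\left(\frac{x-a}{b-a}\,\pi\right).$$ Then $S(\mathcal{X})$ is the set of Chebyshev nodes $$\mathcal{C}_{m+1}=\left\{-\cos\left(\frac{(2i+1)\pi}{2m+2}\right):\ i=0,\ldots,m\right\}$$ on $[-1,1]$, and the weights $w_0^S,\ldots,w_m^S$ of the mapped interpolatory quadrature formula associated with $S$ and $\mathcal{X}$ are given by $$w_i^S=\frac{b-a}{m+1},\qquad i=0,\ldots,m.$$
   Context: Given distinct nodes $x_0,\ldots,x_m\in\Omega=[a,b]$ and an injective map $S:\Omega\to\mathbb{R}$, let $\ell_i^S(y)=\prod_{0\le j\le m,\ j\ne i}\frac{y-S(x_j)}{S(x_i)-S(x_j)}$ be the $i$-th Lagrange polynomial on the mapped nodes $S(x_0),\ldots,S(x_m)$. The mapped interpolatory quadrature formula associated with $S$ and $\mathcal{X}=\{x_0,\ldots,x_m\}$ is $f\mapsto\sum_{i=0}^m w_i^S f(x_i)$ for continuous $f:\Omega\to\mathbb{R}$, with weights $w_i^S=\int_a^b \ell_i^S(S(x))\,\mathrm{d}x$. *)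

theory Defs
  imports "HOL-Analysis.Analysis"
begin

text \<open>
  Nodes $x_0,\ldots,x_m$ are given by the values of \<open>x :: nat \<Rightarrow> real\<close> on \<open>{0..m}\<close>.
  The two general definitions below are meaningful when the nodes are distinct points of
  \<open>{a..b}\<close> and \<open>S\<close> is injective on \<open>{a..b}\<close>.
\<close>

definition lagrange_mapped :: "(real \<Rightarrow> real) \<Rightarrow> (nat \<Rightarrow> real) \<Rightarrow> nat \<Rightarrow> nat \<Rightarrow> real \<Rightarrow> real" where
  "lagrange_mapped S x m i y = (\<Prod>j\<in>{0..m} - {i}. (y - S (x j)) / (S (x i) - S (x j)))"

text \<open>The weights $w_i^S$ of the quadrature formula $f \mapsto \sum_{i=0}^m w_i^S f(x_i)$.\<close>

definition mapped_weight ::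
  "real \<Rightarrow> real \<Rightarrow> (real \<Rightarrow> real) \<Rightarrow> (nat \<Rightarrow> real) \<Rightarrow> nat \<Rightarrow> nat \<Rightarrow> real" where
  "mapped_weight a b S x m i = integral {a..b} (\<lambda>t. lagrange_mapped S x m i (S t))"

definition midpoint_node :: "real \<Rightarrow> real \<Rightarrow> nat \<Rightarrow> nat \<Rightarrow> real" where
  "midpoint_node a b m i = a + (real i + 1 / 2) * ((b - a) / (real m + 1))"

definition cos_map :: "real \<Rightarrow> real \<Rightarrow> real \<Rightarrow> real" where
  "cos_map a b t = - cos ((t - a) / (b - a) * pi)"

definition chebyshev_nodes :: "nat \<Rightarrow> real set" where
  "chebyshev_nodes n = {- cos ((2 * real i + 1) * pi / (2 * real n)) | i. i < n}"

lemma inj_on_midpoint_node: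
  assumes "a < b"
  shows "inj_on (midpoint_node a b m) {0..m}"
  using assms by (auto simp: inj_on_def midpoint_node_def)

lemma midpoint_node_in:
  assumes "a < b" "i \<le> m"
  shows "midpoint_node a b m i \<in> {a..b}"
proof -
  have "(real i + 1 / 2) / (real m + 1) \<le> 1"
    using assms(2) by (simp add: field_simps)
  then have "(real i + 1 / 2) / (real m + 1) * (b - a) \<le> 1 * (b - a)"
    using assms(1) by (intro mult_right_mono) auto
  moreover have "0 \<le> (real i + 1 / 2) * ((b - a) / (real m + 1))"
    using assms(1) by simp
  ultimately show ?thesis
    by (simp add: midpoint_node_def)
qed

end

theory Submission
  imports Defs
begin

text \<open>
  Put \<open>n = m + 1\<close> and \<open>\<theta> t = (t - a) / (b - a) * pi\<close>, so that the map is \<open>S t = - cos (\<theta> t)\<close>. The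
  integrand defining a weight is a polynomial of degree \<open>m\<close> in \<open>cos \<circ> \<theta>\<close>. The point is that the
  \<open>n\<close>-point midpoint rule on \<open>{a..b}\<close>, whose weights are all \<open>(b - a) / n\<close>, integrates such functions
  exactly; this is Gauss--Chebyshev quadrature in the variable \<open>\<theta>\<close>. Applied to the \<open>i\<close>-th Lagrange
  polynomial, which is 1 at node \<open>i\<close> and 0 at the other nodes, the rule returns its own weight
  \<open>(b - a) / n\<close>.

  Exactness starts from the functions \<open>cos (k * \<theta> t)\<close> with \<open>\<bar>k\<bar> < 2 * n\<close>: both the integral
  and the midpoint sum vanish for \<open>k \<noteq> 0\<close> (lemmas \<open>sum_cos_odd_multiples\<close> and
  \<open>midpoint_rule_cos\<close>). The identity \<open>2 cos x cos (k x) = cos ((k + 1) x) + cos ((k - 1) x)\<close> then allows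
  linear factors in \<open>cos \<circ> \<theta>\<close> to be multiplied in one at a time (lemma \<open>midpoint_rule_cos_prod\<close>).
\<close>

section \<open>Exactness of the midpoint rule\<close>

definition angle :: "real \<Rightarrow> real \<Rightarrow> real \<Rightarrow> real" where
  "angle a b t = (t - a) / (b - a) * pi"

lemma cos_map_angle: "cos_map a b t = - cos (angle a b t)"
  by (simp add: cos_map_def angle_def)

lemma angle_midpoint_node:
  assumes "a < b"
  shows "angle a b (midpoint_node a b m i) = (2 * real i + 1) * pi / (2 * (real m + 1))"
proof -
  have "real m + 1 \<noteq> 0" "b - a \<noteq> 0" using assms by auto
  then show ?thesis
    unfolding angle_def midpoint_node_def by (simp add: divide_simps)
qed

lemma angle_bounds:
  assumes "a < b" "t \<in> {a..b}"
  shows "0 \<le> angle a b t" "angle a b t \<le> pi"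
  using assms mult_right_mono[of "(t - a) / (b - a)" 1 pi] by (auto simp: angle_def divide_simps)

text \<open>
  With \<open>h = k * pi / (2 * n)\<close>, multiplication by \<open>2 * sin h\<close> turns the sum into a telescoping one with
  value \<open>sin (k * pi) = 0\<close>; the bound on \<open>k\<close> is what keeps \<open>sin h\<close> away from 0.
\<close>

lemma sum_cos_odd_multiples:
  fixes k n :: nat
  assumes "0 < k" "k < 2 * n"
  shows "(\<Sum>j<n. cos (real k * ((2 * real j + 1) * pi / (2 * real n)))) = 0"
proof -
  define h where "h = real k * pi / (2 * real n)"
  have n: "0 < real n" using assms by simp
  have "0 < h" "h < pi"
    using assms n by (auto simp: h_def divide_simps)
  then have "sin h > 0" by (rule sin_gt_zero)
  have step: "2 * sin h * cos (real k * ((2 * real j + 1) * pi / (2 * real n)))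
      = sin (2 * real (Suc j) * h) - sin (2 * real j * h)" for j
  proof -
    have e: "real k * ((2 * real j + 1) * pi / (2 * real n)) = 2 * real j * h + h"
      by (simp add: h_def add_divide_distrib algebra_simps)
    have s: "2 * real (Suc j) * h = (2 * real j * h + h) + h" by (simp add: algebra_simps)
    have p: "2 * real j * h = (2 * real j * h + h) - h" by simp
    show ?thesis
      unfolding e s by (subst (3) p, unfold sin_add[of _ h] sin_diff) (simp add: algebra_simps)
  qed
  have "2 * sin h * (\<Sum>j<n. cos (real k * ((2 * real j + 1) * pi / (2 * real n))))
      = (\<Sum>j<n. sin (2 * real (Suc j) * h) - sin (2 * real j * h))"
    by (simp only: sum_distrib_left step)
  also have "\<dots> = sin (2 * real n * h)"
    by (subst sum_lessThan_telescope) simp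
  also have "2 * real n * h = real k * pi"
    using n by (simp add: h_def)
  finally show ?thesis
    using \<open>sin h > 0\<close> by simp
qed

lemma midpoint_rule_cos:
  fixes k :: int
  assumes "a < b" "\<bar>k\<bar> < 2 * (int m + 1)"
  shows "((\<lambda>t. cos (of_int k * angle a b t)) has_integral
    (b - a) / (real m + 1) * (\<Sum>l=0..m. cos (of_int k * angle a b (midpoint_node a b m l)))) {a..b}"
proof (cases "k = 0")
  case True
  have "((\<lambda>t::real. 1::real) has_integral (b - a)) {a..b}"
    using has_integral_const_real[of "1::real" a b] assms by simp
  moreover have "1 + real m \<noteq> 0" by linarith
  ultimately show ?thesis using True by (simp add: add.commute[of "real m"])
next
  case False
  define c where "c = pi / (b - a)"
  have c: "c \<noteq> 0" using assms by (simp add: c_def)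
  have ang: "angle a b t = c * (t - a)" for t by (simp add: angle_def c_def)
  have "((\<lambda>t. cos (of_int k * angle a b t)) has_integral
      sin (of_int k * angle a b b) / (of_int k * c) - sin (of_int k * angle a b a) / (of_int k * c)) {a..b}"
    unfolding ang using assms(1) c False
    by (intro fundamental_theorem_of_calculus)
       (auto intro!: derivative_eq_intros
             simp flip: has_real_derivative_iff_has_vector_derivative)
  moreover have "angle a b b = pi" "angle a b a = 0" using assms(1) by (auto simp: angle_def)
  ultimately have I: "((\<lambda>t. cos (of_int k * angle a b t)) has_integral 0) {a..b}"
    by (simp add: mult.commute[of _ pi] sin_int_times_real sin_npi_int)
  have abs: "cos (of_int k * x) = cos (real (nat \<bar>k\<bar>) * x)" for x :: real
    by (cases "k \<ge> 0") (auto simp: abs_if)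
  have "(\<Sum>l=0..m. cos (of_int k * angle a b (midpoint_node a b m l)))
     = (\<Sum>l<m+1. cos (real (nat \<bar>k\<bar>) * ((2 * real l + 1) * pi / (2 * real (m + 1)))))"
    unfolding abs by (rule sum.cong) (use assms in \<open>auto simp: angle_midpoint_node add.commute\<close>)
  also have "\<dots> = 0"
    by (rule sum_cos_odd_multiples) (use False assms in auto)
  finally show ?thesis using I by simp
qed

text \<open>
  The extra factor \<open>cos (k * \<theta>)\<close> makes the induction on the set of linear factors go through, and
  integer frequencies spare a separate case for \<open>k = 0\<close>, where the product formula produces the
  frequency \<open>-1\<close>. The degree bound \<open>2 * m + 1\<close> is that of Gauss--Chebyshev quadrature.
\<close>

lemma midpoint_rule_cos_prod:
  fixes k :: int and p q :: "'i \<Rightarrow> real"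
  assumes "a < b" "finite A" "\<bar>k\<bar> + int (card A) < 2 * (int m + 1)"
  defines "f \<equiv> (\<lambda>k B t. cos (of_int k * angle a b t) * (\<Prod>j\<in>B. p j * cos (angle a b t) + q j))"
  shows "(f k A has_integral
    (b - a) / (real m + 1) * (\<Sum>l=0..m. f k A (midpoint_node a b m l))) {a..b}"
  using assms(2,3)
proof (induction A arbitrary: k rule: finite_induct)
  case empty
  then show ?case
    using midpoint_rule_cos[OF assms(1), of k m] by (simp add: f_def)
next
  case (insert j A)
  have rec: "f k (insert j A) t
      = p j / 2 * f (k + 1) A t + p j / 2 * f (k - 1) A t + q j * f k A t" for t
  proof -
    define P where "P = (\<Prod>j\<in>A. p j * cos (angle a b t) + q j)"
    have up: "cos (of_int (k + 1) * angle a b t) = cos (of_int k * angle a b t) * cos (angle a b t)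
        - sin (of_int k * angle a b t) * sin (angle a b t)"
      by (simp add: distrib_right cos_add)
    have down: "cos (of_int (k - 1) * angle a b t) = cos (of_int k * angle a b t) * cos (angle a b t)
        + sin (of_int k * angle a b t) * sin (angle a b t)"
      by (simp add: left_diff_distrib cos_diff)
    have "f k (insert j A) t = cos (of_int k * angle a b t) * ((p j * cos (angle a b t) + q j) * P)"
      using insert.hyps by (simp add: f_def P_def)
    also have "\<dots> = p j / 2 * (cos (of_int (k + 1) * angle a b t) * P)
        + p j / 2 * (cos (of_int (k - 1) * angle a b t) * P) + q j * (cos (of_int k * angle a b t) * P)"
      unfolding up down by (simp add: field_simps)
    finally show ?thesis by (simp only: f_def P_def)
  qed
  let ?M = "\<lambda>k. (b - a) / (real m + 1) * (\<Sum>l=0..m. f k A (midpoint_node a b m l))"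
  have I: "(f k' A has_integral ?M k') {a..b}" if "k' \<in> {k - 1, k, k + 1}" for k'
    by (rule insert.IH) (use insert.prems insert.hyps that in auto)
  have "((\<lambda>t. p j / 2 * f (k + 1) A t + p j / 2 * f (k - 1) A t + q j * f k A t) has_integral
      p j / 2 * ?M (k + 1) + p j / 2 * ?M (k - 1) + q j * ?M k) {a..b}"
    by (intro has_integral_add has_integral_mult_right I) auto
  moreover have "p j / 2 * ?M (k + 1) + p j / 2 * ?M (k - 1) + q j * ?M k
      = (b - a) / (real m + 1) * (\<Sum>l=0..m. f k (insert j A) (midpoint_node a b m l))"
    unfolding rec by (simp only: sum.distrib flip: sum_distrib_left) (simp only: algebra_simps)
  moreover have "f k (insert j A)
      = (\<lambda>t. p j / 2 * f (k + 1) A t + p j / 2 * f (k - 1) A t + q j * f k A t)"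
    by (rule ext) (rule rec)
  ultimately show ?case by metis
qed

section \<open>The map and its Lagrange polynomials\<close>

lemma bij_betw_cos_map:
  assumes "a < b"
  shows "bij_betw (cos_map a b) {a..b} {-1..1}"
proof (rule bij_betwI')
  fix s t assume st: "s \<in> {a..b}" "t \<in> {a..b}"
  have "cos (angle a b s) = cos (angle a b t) \<longleftrightarrow> angle a b s = angle a b t"
    using cos_inj_pi angle_bounds[OF assms st(1)] angle_bounds[OF assms st(2)] by metis
  then show "cos_map a b s = cos_map a b t \<longleftrightarrow> s = t"
    using assms by (simp add: cos_map_angle angle_def)
next
  fix t show "cos_map a b t \<in> {-1..1}" by (simp add: cos_map_def)
next
  fix y :: real assume y: "y \<in> {-1..1}"
  define t where "t = a + arccos (- y) / pi * (b - a)"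
  have ac: "0 \<le> arccos (- y)" "arccos (- y) \<le> pi"
    using y arccos_lbound[of "-y"] arccos_ubound[of "-y"] by auto
  have "arccos (- y) / pi * (b - a) \<le> 1 * (b - a)"
    using ac assms by (intro mult_right_mono) auto
  then have "t \<in> {a..b}" using ac assms by (simp add: t_def)
  moreover have "angle a b t = arccos (- y)" using assms by (simp add: angle_def t_def)
  then have "cos_map a b t = y" using y by (simp add: cos_map_angle)
  ultimately show "\<exists>t\<in>{a..b}. y = cos_map a b t" by auto
qed

lemma lagrange_mapped_node:
  assumes "i \<le> m" "l \<le> m" "inj_on (\<lambda>j. S (x j)) {0..m}"
  shows "lagrange_mapped S x m i (S (x l)) = (if l = i then 1 else 0)"
proof (cases "l = i")
  case True
  have "S (x i) \<noteq> S (x j)" if "j \<in> {0..m} - {i}" for j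
    using inj_onD[OF assms(3), of i j] assms(1) that by auto
  with True show ?thesis by (simp add: lagrange_mapped_def)
next
  case False
  then show ?thesis
    using assms(2) by (auto simp: lagrange_mapped_def intro!: prod_zero)
qed

lemma mapped_weight_cos_map:
  assumes "a < b" "i \<le> m"
  shows "mapped_weight a b (cos_map a b) (midpoint_node a b m) m i = (b - a) / (real m + 1)"
proof -
  let ?S = "cos_map a b" and ?x = "midpoint_node a b m"
  let ?L = "\<lambda>t. lagrange_mapped ?S ?x m i (?S t)"
  define d where "d j = ?S (?x i) - ?S (?x j)" for j
  have L: "?L t = cos (of_int 0 * angle a b t)
      * (\<Prod>j\<in>{0..m} - {i}. (- 1 / d j) * cos (angle a b t) + (- ?S (?x j) / d j))" for t
    by (simp add: lagrange_mapped_def cos_map_angle d_def diff_divide_distrib)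
  have "card ({0..m} - {i}) = m" using assms(2) by simp
  then have "(?L has_integral (b - a) / (real m + 1) * (\<Sum>l=0..m. ?L (?x l))) {a..b}"
    unfolding L by (intro midpoint_rule_cos_prod) (use assms in auto)
  moreover have "inj_on (\<lambda>j. ?S (?x j)) {0..m}"
  proof (rule inj_onI)
    fix j l assume jl: "j \<in> {0..m}" "l \<in> {0..m}" "?S (?x j) = ?S (?x l)"
    then have "?x j = ?x l"
      using inj_onD[OF bij_betw_imp_inj_on[OF bij_betw_cos_map[OF assms(1)]]]
        midpoint_node_in[OF assms(1)] by (meson atLeastAtMost_iff)
    then show "j = l" using inj_onD[OF inj_on_midpoint_node[OF assms(1)]] jl by blast
  qed
  then have "(\<Sum>l=0..m. ?L (?x l)) = (\<Sum>l=0..m. if l = i then 1 else 0)"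
    using assms(2) by (intro sum.cong) (auto simp: lagrange_mapped_node)
  ultimately show ?thesis
    using assms(2) by (simp add: mapped_weight_def integral_unique)
qed

lemma cos_map_midpoint_nodes:
  assumes "a < b"
  shows "cos_map a b ` (midpoint_node a b m ` {0..m}) = chebyshev_nodes (m + 1)"
proof -
  have "cos_map a b (midpoint_node a b m i) = - cos ((2 * real i + 1) * pi / (2 * real (m + 1)))" for i
    by (simp add: cos_map_angle angle_midpoint_node[OF assms] add.commute)
  moreover have "i \<in> {0..m} \<longleftrightarrow> i < m + 1" for i by auto
  ultimately show ?thesis
    by (auto simp: chebyshev_nodes_def image_image simp del: of_nat_add of_nat_Suc)
qed

theorem mainTheorem1:
  fixes a b :: real and m :: nat
  assumes "a < b"
  shows "bij_betw (cos_map a b) {a..b} {-1..1}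
    \<and> cos_map a b ` (midpoint_node a b m ` {0..m}) = chebyshev_nodes (m + 1)
    \<and> (\<forall>i\<in>{0..m}. mapped_weight a b (cos_map a b) (midpoint_node a b m) m i = (b - a) / (real m + 1))"
  using bij_betw_cos_map[OF assms] cos_map_midpoint_nodes[OF assms]
    mapped_weight_cos_map[OF assms] by simp

end
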